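(* Let $\mathcal S$ be a finite set and let $(X_n)$ be an irreducible, aperiodic Markov chain on $\mathcal S$ with transition matrix $Q$ and invariant distribution $\pi$. Let $\beta\in(0,1]$ and let $T_1,T_2,\dots$ be i.i.d. positive random variables, independent of $(X_n)$, whose common law $\nu$ is the Mittag-Leffler distribution of parameter $\beta$. Let $X(t)=X_{N_\nu(t)}$ be the associated semi-Markov process. Then there is a constant $C_2>0$, not depending on $\varepsilon$ (it may depend on $\beta$ and on the embedded chain), such that for every $\varepsilon>0$ $$T^{\mathrm{cont}}_{\varepsilon} < C_2\, \varepsilon^{-1/\beta}\,\bigl(T^{\mathrm{emb}}_{\varepsilon/2}\bigr)^{1/\beta},$$ where $T^{\mathrm{cont}}_{\varepsilon}$ is the $\varepsilon$-mixing time of $X(t)$ and $T^{\mathrm{emb}}_{\varepsilon/2}$ is the $\varepsilon/2$-mixing time of the embedded chain $(X_n)$.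
   Context: Mittag-Leffler distribution of parameter $\beta\in(0,1]$: the law of a positive random variable $T$ with $\mathbb P\{T>t\}=E_\beta(-t^\beta)$ for $t\ge0$, where $E_\beta(z)=\sum_{k=0}^\infty \frac{z^k}{\Gamma(1+\beta k)}$ is the Mittag-Leffler function. Counting process: $S_0=0$, $S_n=\sum_{k=1}^n T_k$ for $n\ge 1$, and $N_\nu(t)=\max\{n\ge 0: S_n\le t\}$ for $t\ge 0$. The semi-Markov process is $X(t)=X_{N_\nu(t)}$; $(X_n)$ is called the embedded chain. Transition probabilities: $q^{(n)}_{i,j}=(Q^n)_{i,j}$ are the $n$-step transition probabilities of the embedded chain, and $p_{i,j}(t)=\mathbb P\{X(t)=j\mid X(0)=i\}$, that is, $$p_{i,j}(t)=\mathbb P\{T_1>t\}\,\delta_{ij}+\sum_{n=1}^\infty q^{(n)}_{i,j}\,\mathbb P\{N_\nu(t)=n\}.$$ Total variation distance: $\|\mu-\rho\|=\tfrac12\sum_{x\in\mathcal S}|\mu(x)-\rho(x)|$ for probability measures $\mu,\rho$ on $\mathcal S$. Mixing times (note the sum over starting states $i$): for $\varepsilon>0$, $$T^{\mathrm{emb}}_\varepsilon=\inf\Bigl\{n\in\{1,2,3,\dots\}:\ \sum_{i\in\mathcal S}\|q^{(n)}_{i,\cdot}-\pi\|\le\varepsilon\Bigr\},\qquad T^{\mathrm{cont}}_\varepsilon=\inf\Bigl\{t\ge 0:\ \sum_{i\in\mathcal S}\|p_{i,\cdot}(t)-\pi\|\le\varepsilon\Bigr\}.$$ *)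

theory Defs
  imports "HOL-Probability.Probability"
begin

section \<open>Finite Markov chains\<close>

definition transition_matrix :: "real^'s^'s::finite \<Rightarrow> bool" where
  "transition_matrix Q \<longleftrightarrow> (\<forall>i j. 0 \<le> Q $ i $ j) \<and> (\<forall>i. (\<Sum>j\<in>UNIV. Q $ i $ j) = 1)"

definition nstep :: "real^'s^'s::finite \<Rightarrow> nat \<Rightarrow> 's \<Rightarrow> 's \<Rightarrow> real" where
  "nstep Q n i j = (((**) Q ^^ n) (mat 1)) $ i $ j"

definition irreducible_chain :: "real^'s^'s::finite \<Rightarrow> bool" where
  "irreducible_chain Q \<longleftrightarrow> (\<forall>i j. \<exists>n. 0 < nstep Q n i j)"

definition aperiodic_chain :: "real^'s^'s::finite \<Rightarrow> bool" where
  "aperiodic_chain Q \<longleftrightarrow> (\<forall>i. Gcd {n. 1 \<le> n \<and> 0 < nstep Q n i i} = 1)"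

definition invariant_distribution :: "real^'s^'s::finite \<Rightarrow> real^'s \<Rightarrow> bool" where
  "invariant_distribution Q \<pi> \<longleftrightarrow>
     (\<forall>i. 0 \<le> \<pi> $ i) \<and> (\<Sum>i\<in>UNIV. \<pi> $ i) = 1 \<and> \<pi> v* Q = \<pi>"

definition markov_chain :: "'w measure \<Rightarrow> real^'s^'s::finite \<Rightarrow> (nat \<Rightarrow> 'w \<Rightarrow> 's) \<Rightarrow> bool" where
  "markov_chain M Q X \<longleftrightarrow>
     (\<forall>n. X n \<in> measurable M (count_space UNIV)) \<and>
     (\<forall>n (x :: nat \<Rightarrow> 's) j.
        \<P>(\<omega> in M. \<forall>k\<le>n. X k \<omega> = x k) > 0 \<longrightarrow>
        \<P>(\<omega> in M. X (Suc n) \<omega> = j \<bar> \<forall>k\<le>n. X k \<omega> = x k) = Q $ x n $ j)"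


section \<open>Mittag-Leffler waiting times\<close>

definition mittag_leffler :: "real \<Rightarrow> real \<Rightarrow> real" where
  "mittag_leffler \<beta> z = (\<Sum>k. z ^ k / Gamma (1 + \<beta> * real k))"

definition mittag_leffler_law :: "real \<Rightarrow> real measure \<Rightarrow> bool" where
  "mittag_leffler_law \<beta> \<nu> \<longleftrightarrow>
     prob_space \<nu> \<and> sets \<nu> = sets borel \<and> measure \<nu> {0<..} = 1 \<and>
     (\<forall>t\<ge>0. measure \<nu> {t<..} = mittag_leffler \<beta> (- (t powr \<beta>)))"

text \<open>The waiting times are \<open>T 1, T 2, \<dots>\<close>; the value \<open>T 0\<close> plays no role here or below.\<close>

definition arrival_time :: "(nat \<Rightarrow> 'w \<Rightarrow> real) \<Rightarrow> nat \<Rightarrow> 'w \<Rightarrow> real" where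
  "arrival_time T n \<omega> = (\<Sum>k=1..n. T k \<omega>)"

text \<open>For i.i.d. positive waiting times the set below is finite and nonempty for almost every
  \<open>\<omega>\<close>, so the unspecified value of \<^const>\<open>Max\<close> on other sets only matters on a null set.\<close>

definition counting_process :: "(nat \<Rightarrow> 'w \<Rightarrow> real) \<Rightarrow> real \<Rightarrow> 'w \<Rightarrow> nat" where
  "counting_process T t \<omega> = Max {n. arrival_time T n \<omega> \<le> t}"

definition semi_markov :: "(nat \<Rightarrow> 'w \<Rightarrow> 's) \<Rightarrow> (nat \<Rightarrow> 'w \<Rightarrow> real) \<Rightarrow> real \<Rightarrow> 'w \<Rightarrow> 's" where
  "semi_markov X T t \<omega> = X (counting_process T t \<omega>) \<omega>"

text \<open>Independence of the generated \<open>\<sigma>\<close>-algebras; \<open>indep_var\<close> is not applicable because the two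
  processes take values in different types.\<close>

definition indep_chain_times ::
    "'w measure \<Rightarrow> (nat \<Rightarrow> 'w \<Rightarrow> 's) \<Rightarrow> (nat \<Rightarrow> 'w \<Rightarrow> real) \<Rightarrow> bool" where
  "indep_chain_times M X T \<longleftrightarrow>
     prob_space.indep_set M
       (sets (vimage_algebra (space M) (\<lambda>\<omega> n. X n \<omega>) (PiM UNIV (\<lambda>_. count_space UNIV))))
       (sets (vimage_algebra (space M) (\<lambda>\<omega>. \<lambda>k\<in>{1..}. T k \<omega>) (PiM {1..} (\<lambda>_. borel))))"

text \<open>\<open>P i\<close> is the law given that the chain starts at \<open>i\<close>, that is
  \<open>\<P>{\<cdot> | X(0) = i}\<close>. Working with one probability measure per starting state makes
  the transition probabilities of the semi-Markov process meaningful for every \<open>i\<close>, without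
  assuming that some initial distribution charges all states.\<close>

definition semi_markov_family ::
    "real^'s^'s::finite \<Rightarrow> real measure \<Rightarrow> ('s \<Rightarrow> 'w measure) \<Rightarrow>
     (nat \<Rightarrow> 'w \<Rightarrow> 's) \<Rightarrow> (nat \<Rightarrow> 'w \<Rightarrow> real) \<Rightarrow> bool" where
  "semi_markov_family Q \<nu> P X T \<longleftrightarrow>
     (\<forall>i. prob_space (P i) \<and>
          markov_chain (P i) Q X \<and> (AE \<omega> in P i. X 0 \<omega> = i) \<and>
          prob_space.indep_vars (P i) (\<lambda>_. borel) T {1..} \<and>
          (\<forall>k\<ge>1. distr (P i) borel (T k) = \<nu>) \<and>
          indep_chain_times (P i) X T)"

definition transition_prob ::
    "('s \<Rightarrow> 'w measure) \<Rightarrow> (real \<Rightarrow> 'w \<Rightarrow> 's) \<Rightarrow> real \<Rightarrow> 's \<Rightarrow> 's \<Rightarrow> real" where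
  "transition_prob P Y t i j = \<P>(\<omega> in P i. Y t \<omega> = j)"


section \<open>Mixing times\<close>

definition tv_dist :: "('s::finite \<Rightarrow> real) \<Rightarrow> ('s \<Rightarrow> real) \<Rightarrow> real" where
  "tv_dist \<mu> \<rho> = (1/2) * (\<Sum>x\<in>UNIV. \<bar>\<mu> x - \<rho> x\<bar>)"

definition mixing_time_emb :: "real^'s^'s::finite \<Rightarrow> real^'s \<Rightarrow> real \<Rightarrow> nat" where
  "mixing_time_emb Q \<pi> \<epsilon> =
     Inf {n. 1 \<le> n \<and> (\<Sum>i\<in>UNIV. tv_dist (nstep Q n i) (($) \<pi>)) \<le> \<epsilon>}"

text \<open>In \<^typ>\<open>ereal\<close> the infimum of the empty set is \<open>\<infinity>\<close>, so a finite upper bound includes the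
  claim that the continuous-time mixing time is finite. In \<^typ>\<open>nat\<close> the infimum of the empty set
  is 0, so a positive lower bound on the discrete mixing time includes the claim that the
  chain mixes.\<close>

definition mixing_time_cont ::
    "('s::finite \<Rightarrow> 'w measure) \<Rightarrow> (real \<Rightarrow> 'w \<Rightarrow> 's) \<Rightarrow> real^'s \<Rightarrow> real \<Rightarrow> ereal" where
  "mixing_time_cont P Y \<pi> \<epsilon> =
     Inf (ereal ` {t. 0 \<le> t \<and> (\<Sum>i\<in>UNIV. tv_dist (transition_prob P Y t i) (($) \<pi>)) \<le> \<epsilon>})"

end

theory Submission
  imports Defs
begin

text \<open>Write \<open>q\<^sup>(\<^sup>k\<^sup>)\<close> for the \<open>k\<close>-step transition probabilities and \<open>N\<close> for the number of jumps up to time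
  \<open>t\<close>. Since the jump times are independent of the embedded chain, the law of the process at time
  \<open>t\<close> is the mixture of the \<open>k\<close>-step laws \<open>q\<^sup>(\<^sup>k\<^sup>)\<close> with weights \<open>\<P>(N = k)\<close> (\<open>semi_markov_prob_sums\<close>). The distance of
  \<open>q\<^sup>(\<^sup>k\<^sup>)\<close> to \<open>\<pi>\<close> never exceeds \<open>1\<close> and does not increase with \<open>k\<close>, so for every \<open>n\<close> the distance at time \<open>t\<close> is at
  most \<open>\<P>(N < n) + \<parallel>q\<^sup>(\<^sup>n\<^sup>) - \<pi>\<parallel>\<close> (\<open>tv_dist_mixture_le\<close>). For \<open>n\<close> the discrete mixing time at level
  \<open>\<epsilon>/2\<close>, the second terms add up to at most \<open>\<epsilon>/2\<close> over all starting states, and it remains to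
  choose \<open>t\<close> with \<open>\<P>(N < n) \<le> \<epsilon>/(2|S|)\<close>.

  The event \<open>N < n\<close> means that the \<open>n\<close>-th jump comes after \<open>t\<close>. If a sum of \<open>n\<close> terms exceeds \<open>t\<close>,
  then the sum of the terms truncated at \<open>t\<close> still reaches \<open>t\<close>, and Markov's inequality
  bounds the probability by \<open>n \<sqdot> \<E>[min(T/t, 1)]\<close> (\<open>prob_sum_gt_le\<close>). So everything rests on the
  estimate \<open>\<E>[min(T/t, 1)] \<le> \<Gamma>(\<beta>) t\<^sup>-\<^sup>\<beta>\<close> (\<open>mittag_leffler_truncated_mean\<close>), which has the right order
  for heavy tails and for the exponential case \<open>\<beta> = 1\<close> alike. It comes from the fractional
  relaxation equation for the tail \<open>F(t) = E\<^sub>\<beta>(-t\<^sup>\<beta>)\<close>,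
  \<open>F(t) = 1 - \<Gamma>(\<beta>)\<^sup>-\<^sup>1 \<integral>\<^sub>0\<^sup>t (t - s)\<^sup>\<beta>\<^sup>-\<^sup>1 F(s) ds\<close>: the kernel is at least \<open>t\<^sup>\<beta>\<^sup>-\<^sup>1\<close> because \<open>\<beta> \<le> 1\<close>, and \<open>F\<close> is
  nonnegative because it is the tail of a probability law. Taking \<open>t\<^sup>\<beta> = 2 |S| \<Gamma>(\<beta>) n / \<epsilon>\<close> gives the
  theorem.

  Two facts make these quantities meaningful: only finitely many jumps occur up to time \<open>t\<close> almost
  surely (\<open>AE_finite_arrivals\<close>), so that \<open>N < n\<close> does imply that the \<open>n\<close>-th jump is late; and the
  embedded chain converges to \<open>\<pi>\<close> (\<open>tv_dist_nstep_tendsto_0\<close>), so that its mixing time is positive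
  and attained.\<close>

section \<open>The Mittag-Leffler function\<close>

text \<open>Keep only the part \<open>s \<ge> y\<close> of Euler's integral, where \<open>s powr x \<ge> y powr x\<close>. With \<open>y\<close> free, this
  makes the Gamma function grow faster than every geometric sequence, which is all that the
  convergence of the Mittag-Leffler series needs.\<close>

lemma Gamma_ge_power_exp:
  fixes x y :: real
  assumes "0 \<le> x" "0 < y"
  shows "y powr x * exp (- y) \<le> Gamma (1 + x)"
proof -
  have int: "integral\<^sup>N lborel (\<lambda>s. ennreal (indicator {y..} s * exp (- s))) = ennreal (exp (- y))"
  proof -
    have "((\<lambda>s::real. - exp (- s)) \<longlongrightarrow> - 0) at_top"
      by (intro tendsto_minus filterlim_compose[OF exp_at_bot filterlim_uminus_at_bot_at_top])
    then have "integral\<^sup>N lborel (\<lambda>s. ennreal (exp (- s)) * indicator {y..} s) =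
        ennreal (0 - (- exp (- y)))"
      by (intro nn_integral_FTC_atLeast) (auto intro!: derivative_eq_intros)
    then show ?thesis
      by (simp add: ennreal_mult'' mult.commute ennreal_indicator)
  qed
  have "ennreal (y powr x * exp (- y)) =
      ennreal (y powr x) * integral\<^sup>N lborel (\<lambda>s. ennreal (indicator {y..} s * exp (- s)))"
    unfolding int by (intro ennreal_mult) auto
  also have "\<dots> =
      (\<integral>\<^sup>+s. ennreal (y powr x) * ennreal (indicator {y..} s * exp (- s)) \<partial>lborel)"
    by (intro nn_integral_cmult [symmetric]) measurable
  also have "\<dots> \<le> (\<integral>\<^sup>+s. ennreal (indicator {0..} s * s powr ((1 + x) - 1) / exp s) \<partial>lborel)"
    using assms
    by (intro nn_integral_mono)
       (auto simp: indicator_def exp_minus divide_simps powr_mono2 simp flip: ennreal_mult''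
          intro!: ennreal_leI)
  also have "\<dots> = ennreal (Gamma (1 + x))"
    using Gamma_conv_nn_integral_real[of "1 + x"] assms by simp
  finally show ?thesis
    using assms by (simp add: Gamma_real_nonneg)
qed

lemma summable_mittag_leffler:
  fixes \<beta> z :: real
  assumes "0 < \<beta>"
  shows "summable (\<lambda>k. \<bar>z\<bar> ^ k / Gamma (1 + \<beta> * real k))"
proof -
  \<comment> \<open>With this \<open>y\<close> the lower bound for the Gamma function is \<open>(2 (\<bar>z\<bar> + 1))\<^sup>k\<close> up to a constant.\<close>
  define y where "y = (2 * (\<bar>z\<bar> + 1)) powr (1 / \<beta>)"
  have y: "0 < y" by (simp add: y_def)
  have y_powr: "y powr (\<beta> * real k) = (2 * (\<bar>z\<bar> + 1)) ^ k" for k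
    using assms by (simp add: y_def powr_powr powr_realpow)
  show ?thesis
  proof (rule summable_comparison_test'[where N = 0])
    show "summable (\<lambda>k. exp y * (1 / 2 :: real) ^ k)"
      by (intro summable_mult summable_geometric) auto
    fix k :: nat
    have G: "(2 * (\<bar>z\<bar> + 1)) ^ k * exp (- y) \<le> Gamma (1 + \<beta> * real k)"
      using Gamma_ge_power_exp[of "\<beta> * real k" y] assms y by (simp add: y_powr)
    have pos: "0 < (2 * (\<bar>z\<bar> + 1)) ^ k * exp (- y)"
      by (intro mult_pos_pos zero_less_power) auto
    have "\<bar>z\<bar> ^ k / Gamma (1 + \<beta> * real k) \<le> (\<bar>z\<bar> + 1) ^ k / ((2 * (\<bar>z\<bar> + 1)) ^ k * exp (- y))"
      using G pos by (intro frac_le power_mono) auto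
    also have "\<dots> = exp y * (1 / 2) ^ k"
      unfolding power_mult_distrib by (simp add: exp_minus divide_simps)
    finally show "norm (\<bar>z\<bar> ^ k / Gamma (1 + \<beta> * real k)) \<le> exp y * (1 / 2) ^ k"
      using order.strict_trans2[OF pos G] by (simp add: abs_div)
  qed
qed

lemma Beta_moment:
  fixes \<beta> :: real
  assumes "0 < \<beta>"
  defines "f \<equiv> \<lambda>k u. indicator {0<..<1} u * (u powr (\<beta> * real k) * (1 - u) powr (\<beta> - 1))"
  shows "integrable lborel (f k)"
    and "(\<integral>u. f k u \<partial>lborel) = Gamma (1 + \<beta> * real k) * Gamma \<beta> / Gamma (1 + \<beta> * real (Suc k))"
proof -
  have "set_integrable lborel {0..1} (\<lambda>u. u powr ((1 + \<beta> * real k) - 1) * (1 - u) powr (\<beta> - 1))"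
    using assms by (intro integrable_Beta add_pos_nonneg) auto
  then have "set_integrable lborel {0..1} (\<lambda>u. u powr (\<beta> * real k) * (1 - u) powr (\<beta> - 1))"
    by simp
  then have si: "set_integrable lborel {0<..<1} (\<lambda>u. u powr (\<beta> * real k) * (1 - u) powr (\<beta> - 1))"
    by (rule set_integrable_subset) auto
  then show "integrable lborel (f k)"
    by (simp add: set_integrable_def f_def)
  have "((\<lambda>u. u powr ((1 + \<beta> * real k) - 1) * (1 - u) powr (\<beta> - 1))
      has_integral Beta (1 + \<beta> * real k) \<beta>) {0..1}"
    using assms by (intro has_integral_Beta_real add_pos_nonneg) auto
  then have "((\<lambda>u. u powr (\<beta> * real k) * (1 - u) powr (\<beta> - 1))
      has_integral Beta (1 + \<beta> * real k) \<beta>) {0<..<1}"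
    by (simp add: has_integral_Icc_iff_Ioo)
  moreover have "(LINT u:{0<..<1}|lborel. u powr (\<beta> * real k) * (1 - u) powr (\<beta> - 1)) =
      integral {0<..<1} (\<lambda>u. u powr (\<beta> * real k) * (1 - u) powr (\<beta> - 1))"
    by (rule set_borel_integral_eq_integral[OF si])
  ultimately show "(\<integral>u. f k u \<partial>lborel) =
      Gamma (1 + \<beta> * real k) * Gamma \<beta> / Gamma (1 + \<beta> * real (Suc k))"
    by (simp add: integral_unique f_def set_lebesgue_integral_def Beta_def algebra_simps)
qed

text \<open>With the substitution \<open>s = t u\<close> this is the fractional relaxation equation
  \<open>F(t) = 1 - \<Gamma>(\<beta>)\<^sup>-\<^sup>1 \<integral>\<^sub>0\<^sup>t (t - s)\<^sup>\<beta>\<^sup>-\<^sup>1 F(s) ds\<close> for \<open>F(t) = E\<^sub>\<beta>(-t\<^sup>\<beta>)\<close>. Integrating the series term by term,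
  the Beta integral of the \<open>k\<close>-th term replaces \<open>\<Gamma>(1 + \<beta>k)\<close> by \<open>\<Gamma>(1 + \<beta>(k + 1))\<close>, so up to the
  factor \<open>-\<Gamma>(\<beta>)/t\<^sup>\<beta>\<close> the integral is the same series without its first term.\<close>

lemma mittag_leffler_volterra:
  fixes \<beta> t :: real
  assumes \<beta>: "0 < \<beta>" and t: "0 < t"
  defines "g \<equiv> \<lambda>u. indicator {0<..<1} u *
    ((1 - u) powr (\<beta> - 1) * mittag_leffler \<beta> (- ((t * u) powr \<beta>)))"
  shows "integrable lborel g"
    and "t powr \<beta> * (\<integral>u. g u \<partial>lborel) = Gamma \<beta> * (1 - mittag_leffler \<beta> (- (t powr \<beta>)))"
proof -
  define x where "x = t powr \<beta>"
  have x: "0 < x" using t by (simp add: x_def)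
  define c where "c k = (- x) ^ k / Gamma (1 + \<beta> * real k)" for k
  define h where "h k u = c k *
    (indicator {0<..<1} u * (u powr (\<beta> * real k) * (1 - u) powr (\<beta> - 1)))" for k and u :: real
  have Gpos: "0 < Gamma (1 + \<beta> * real k)" for k
    using \<beta> by (intro Gamma_real_pos add_pos_nonneg) auto
  have abs_c: "\<bar>c k\<bar> = x ^ k / Gamma (1 + \<beta> * real k)" for k
    using x Gpos[of k] by (simp add: c_def abs_div power_abs)
  have sum_c: "summable (\<lambda>k. \<bar>c k\<bar>)"
    using summable_mittag_leffler[OF \<beta>, of x] x by (simp add: abs_c)
  have h_int: "integrable lborel (h k)" for k
    unfolding h_def by (intro integrable_mult_right Beta_moment(1) \<beta>)
  have h_eq: "(\<integral>u. h k u \<partial>lborel) = - (Gamma \<beta> / x) * c (Suc k)" for k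
  proof -
    have "(\<integral>u. h k u \<partial>lborel) =
        c k * (Gamma (1 + \<beta> * real k) * Gamma \<beta> / Gamma (1 + \<beta> * real (Suc k)))"
      unfolding h_def using Beta_moment(2)[OF \<beta>, of k] by simp
    also have "\<dots> = (- x) ^ k * Gamma \<beta> / Gamma (1 + \<beta> * real (Suc k))"
      using Gpos[of k] by (simp add: c_def)
    also have "\<dots> = - (Gamma \<beta> / x) * c (Suc k)"
      using x by (simp add: c_def)
    finally show ?thesis .
  qed
  have g_eq: "g u = (\<Sum>k. h k u)" for u
  proof (cases "u \<in> {0<..<1}")
    case True
    have "(- ((t * u) powr \<beta>)) ^ k = (- x) ^ k * u powr (\<beta> * real k)" for k
    proof -
      have "- ((t * u) powr \<beta>) = (- x) * u powr \<beta>"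
        using True t by (simp add: x_def powr_mult)
      then show ?thesis
        using True by (simp only: power_mult_distrib) (simp add: powr_powr flip: powr_realpow)
    qed
    then have "(- ((t * u) powr \<beta>)) ^ k / Gamma (1 + \<beta> * real k) = c k * u powr (\<beta> * real k)" for k
      by (simp add: c_def)
    then have ml: "mittag_leffler \<beta> (- ((t * u) powr \<beta>)) = (\<Sum>k. c k * u powr (\<beta> * real k))"
      by (simp add: mittag_leffler_def)
    have "summable (\<lambda>k. c k * u powr (\<beta> * real k))"
    proof (rule summable_comparison_test'[OF sum_c, of 0])
      fix k
      have "u powr (\<beta> * real k) \<le> 1 powr (\<beta> * real k)"
        using True \<beta> by (intro powr_mono2) auto
      then show "norm (c k * u powr (\<beta> * real k)) \<le> \<bar>c k\<bar>"
        by (simp add: abs_mult mult_left_le)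
    qed
    then show ?thesis
      using True suminf_mult[of "\<lambda>k. c k * u powr (\<beta> * real k)" "(1 - u) powr (\<beta> - 1)"]
      by (simp add: g_def h_def ml mult_ac)
  next
    case False
    then show ?thesis by (simp add: g_def h_def)
  qed
  have norm_h: "norm (h k u) = \<bar>c k\<bar> *
      (indicator {0<..<1} u * (u powr (\<beta> * real k) * (1 - u) powr (\<beta> - 1)))" for k u
    by (simp add: h_def abs_mult indicator_def)
  have AE: "AE u in lborel. summable (\<lambda>k. norm (h k u))"
  proof (rule AE_I2)
    fix u :: real
    show "summable (\<lambda>k. norm (h k u))"
    proof (rule summable_comparison_test'[OF summable_mult2[OF sum_c, of "(1 - u) powr (\<beta> - 1)"], of 0])
      fix k
      have "u powr (\<beta> * real k) \<le> 1 powr (\<beta> * real k)" if "0 < u" "u < 1"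
        using that \<beta> by (intro powr_mono2) auto
      then show "norm (norm (h k u)) \<le> \<bar>c k\<bar> * (1 - u) powr (\<beta> - 1)"
        unfolding norm_h
        by (auto simp: indicator_def abs_mult intro!: mult_left_mono mult_left_le_one_le)
    qed
  qed
  have "(\<integral>u. norm (h k u) \<partial>lborel) = Gamma \<beta> / x * \<bar>c (Suc k)\<bar>" for k
  proof -
    have "(\<integral>u. norm (h k u) \<partial>lborel) =
        \<bar>c k\<bar> * (Gamma (1 + \<beta> * real k) * Gamma \<beta> / Gamma (1 + \<beta> * real (Suc k)))"
      unfolding norm_h using Beta_moment(2)[OF \<beta>, of k] by simp
    also have "\<dots> = x ^ k * Gamma \<beta> / Gamma (1 + \<beta> * real (Suc k))"
      using Gpos[of k] by (simp add: abs_c)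
    also have "\<dots> = Gamma \<beta> / x * \<bar>c (Suc k)\<bar>"
      using x by (simp add: abs_c)
    finally show ?thesis .
  qed
  moreover have "summable (\<lambda>k. Gamma \<beta> / x * \<bar>c (Suc k)\<bar>)"
    using sum_c summable_Suc_iff[of "\<lambda>k. \<bar>c k\<bar>"] by (intro summable_mult) simp
  ultimately have sum_int: "summable (\<lambda>k. \<integral>u. norm (h k u) \<partial>lborel)"
    by simp
  show "integrable lborel g"
    using integrable_suminf[OF h_int AE sum_int] by (simp add: g_eq[abs_def])
  have sc: "summable c"
    using sum_c summable_rabs_cancel by blast
  have "(\<integral>u. g u \<partial>lborel) = (\<Sum>k. \<integral>u. h k u \<partial>lborel)"
    using integral_suminf[OF h_int AE sum_int] by (simp add: g_eq[abs_def])
  also have "\<dots> = - (Gamma \<beta> / x) * (\<Sum>k. c (Suc k))"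
    unfolding h_eq using sc by (intro suminf_mult) (simp only: summable_Suc_iff)
  also have "(\<Sum>k. c (Suc k)) = mittag_leffler \<beta> (- x) - 1"
    using suminf_split_head[OF sc] by (simp add: mittag_leffler_def c_def[abs_def])
  finally show "t powr \<beta> * (\<integral>u. g u \<partial>lborel) = Gamma \<beta> * (1 - mittag_leffler \<beta> (- (t powr \<beta>)))"
    using x by (simp add: x_def[symmetric] field_simps)
qed

section \<open>Truncated waiting times\<close>

text \<open>By Fubini the left-hand side is \<open>\<integral>\<^sub>0\<^sup>1 \<P>(T > t u) du\<close>. Inserting the weight \<open>(1 - u) powr (\<beta> - 1) \<ge> 1\<close>
  only increases it, and the weighted integral is at most \<open>\<Gamma>(\<beta>) t powr -\<beta>\<close> by
  \<open>mittag_leffler_volterra\<close>.\<close>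

lemma mittag_leffler_truncated_mean:
  fixes \<beta> t :: real
  assumes \<beta>: "0 < \<beta>" "\<beta> \<le> 1" and law: "mittag_leffler_law \<beta> \<nu>" and t: "0 < t"
  shows "(\<integral>\<^sup>+x. ennreal (max 0 (min 1 (x / t))) \<partial>\<nu>) \<le> ennreal (Gamma \<beta> * t powr (- \<beta>))"
proof -
  have [measurable_cong]: "sets \<nu> = sets borel"
    using law by (simp add: mittag_leffler_law_def)
  interpret prob_space \<nu>
    using law by (simp add: mittag_leffler_law_def)
  interpret pair_sigma_finite lborel \<nu> ..
  define F where "F s = mittag_leffler \<beta> (- (s powr \<beta>))" for s :: real
  have F: "measure \<nu> {s<..} = F s" if "0 \<le> s" for s
    using law that by (simp add: mittag_leffler_law_def F_def)
  have F_nonneg: "0 \<le> F s" if "0 \<le> s" for s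
    using F[OF that] measure_nonneg[of \<nu> "{s<..}"] by simp
  define g where "g u = indicator {0<..<1} u * ((1 - u) powr (\<beta> - 1) * F (t * u))" for u
  note volt = mittag_leffler_volterra[OF \<beta>(1) t, folded F_def, folded g_def]
  have "(\<integral>\<^sup>+x. ennreal (max 0 (min 1 (x / t))) \<partial>\<nu>) =
      (\<integral>\<^sup>+x. (\<integral>\<^sup>+u. indicator {0<..<1} u * indicator {t * u<..} x \<partial>lborel) \<partial>\<nu>)"
  proof (rule nn_integral_cong)
    fix x
    have "(\<integral>\<^sup>+u. indicator {0<..<1} u * indicator {t * u<..} x \<partial>lborel) =
        (\<integral>\<^sup>+u. indicator {0<..<max 0 (min 1 (x / t))} u \<partial>lborel)"
    proof (rule nn_integral_cong)
      fix u :: real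
      have "t * u < x \<longleftrightarrow> u < x / t"
        using t by (simp add: less_divide_eq mult.commute)
      then show "indicator {0<..<1} u * indicator {t * u<..} x =
          (indicator {0<..<max 0 (min 1 (x / t))} u :: ennreal)"
        by (auto simp: indicator_def less_max_iff_disj)
    qed
    then show "ennreal (max 0 (min 1 (x / t))) =
        (\<integral>\<^sup>+u. indicator {0<..<1} u * indicator {t * u<..} x \<partial>lborel)"
      by simp
  qed
  also have "\<dots> = (\<integral>\<^sup>+u. (\<integral>\<^sup>+x. indicator {0<..<1} u * indicator {t * u<..} x \<partial>\<nu>) \<partial>lborel)"
    by (rule Fubini') (unfold greaterThan_def, measurable)
  also have "\<dots> = (\<integral>\<^sup>+u. indicator {0<..<1} u * emeasure \<nu> {t * u<..} \<partial>lborel)"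
    by (simp add: nn_integral_cmult)
  also have "\<dots> \<le> (\<integral>\<^sup>+u. ennreal (g u) \<partial>lborel)"
  proof (rule nn_integral_mono)
    fix u :: real
    show "indicator {0<..<1} u * emeasure \<nu> {t * u<..} \<le> ennreal (g u)"
    proof (cases "u \<in> {0<..<1}")
      case True
      then have "1 powr (\<beta> - 1) \<le> (1 - u) powr (\<beta> - 1)"
        using \<beta> by (intro powr_mono2') auto
      then have "F (t * u) \<le> (1 - u) powr (\<beta> - 1) * F (t * u)"
        using mult_right_mono[of 1 "(1 - u) powr (\<beta> - 1)" "F (t * u)"] F_nonneg[of "t * u"] True t
        by simp
      then show ?thesis
        using True t by (auto simp: g_def emeasure_eq_measure F intro!: ennreal_leI)
    qed simp
  qed
  also have "\<dots> = ennreal (\<integral>u. g u \<partial>lborel)"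
    using volt(1) t F_nonneg by (intro nn_integral_eq_integral) (auto simp: g_def indicator_def)
  also have "\<dots> \<le> ennreal (Gamma \<beta> * t powr (- \<beta>))"
  proof (rule ennreal_leI)
    have "t powr \<beta> * (\<integral>u. g u \<partial>lborel) \<le> Gamma \<beta>"
      using volt(2) F_nonneg[of t] t \<beta> Gamma_real_pos[of \<beta>] by simp
    then show "(\<integral>u. g u \<partial>lborel) \<le> Gamma \<beta> * t powr (- \<beta>)"
      using t by (simp add: powr_minus field_simps)
  qed
  finally show ?thesis .
qed

text \<open>Markov's inequality for the truncated sum. If \<open>\<Sum>Y\<^sub>k > t\<close>, then the quotients \<open>Y\<^sub>k/t\<close>, truncated to
  \<open>[0, 1]\<close>, still have sum at least \<open>1\<close>: either a single one becomes \<open>1\<close>, or the truncation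
  lowers none of them. Truncating keeps the bound useful when the \<open>Y\<^sub>k\<close>
  have infinite mean.\<close>

lemma (in prob_space) prob_sum_gt_le:
  fixes Y :: "'i \<Rightarrow> 'a \<Rightarrow> real"
  assumes I: "finite I" and Y: "\<And>k. k \<in> I \<Longrightarrow> random_variable borel (Y k)"
    and "0 < t" "0 \<le> b"
    and mean: "\<And>k. k \<in> I \<Longrightarrow> (\<integral>\<^sup>+\<omega>. ennreal (max 0 (min 1 (Y k \<omega> / t))) \<partial>M) \<le> ennreal b"
  shows "\<P>(\<omega> in M. t < (\<Sum>k\<in>I. Y k \<omega>)) \<le> real (card I) * b"
proof -
  note [measurable] = Y
  have "emeasure M {\<omega> \<in> space M. t < (\<Sum>k\<in>I. Y k \<omega>)} =
      (\<integral>\<^sup>+\<omega>. indicator {\<omega> \<in> space M. t < (\<Sum>k\<in>I. Y k \<omega>)} \<omega> \<partial>M)"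
    by simp
  also have "\<dots> \<le> (\<integral>\<^sup>+\<omega>. (\<Sum>k\<in>I. ennreal (max 0 (min 1 (Y k \<omega> / t)))) \<partial>M)"
  proof (rule nn_integral_mono)
    fix \<omega>
    have "1 \<le> (\<Sum>k\<in>I. max 0 (min 1 (Y k \<omega> / t)))" if gt: "t < (\<Sum>k\<in>I. Y k \<omega>)"
    proof (cases "\<exists>k\<in>I. t \<le> Y k \<omega>")
      case True
      then obtain k where k: "k \<in> I" "t \<le> Y k \<omega>" by blast
      then have "1 = max 0 (min 1 (Y k \<omega> / t))"
        using \<open>0 < t\<close> by simp
      also have "\<dots> \<le> (\<Sum>k\<in>I. max 0 (min 1 (Y k \<omega> / t)))"
        using k I by (intro member_le_sum) auto
      finally show ?thesis .
    next
      case False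
      have "1 \<le> (\<Sum>k\<in>I. Y k \<omega>) / t"
        using gt \<open>0 < t\<close> by simp
      also have "\<dots> = (\<Sum>k\<in>I. Y k \<omega> / t)"
        by (simp add: sum_divide_distrib)
      also have "\<dots> \<le> (\<Sum>k\<in>I. max 0 (min 1 (Y k \<omega> / t)))"
        using False \<open>0 < t\<close> by (intro sum_mono) (auto simp: not_le less_imp_le)
      finally show ?thesis .
    qed
    then have "indicator {\<omega> \<in> space M. t < (\<Sum>k\<in>I. Y k \<omega>)} \<omega>
        \<le> ennreal (\<Sum>k\<in>I. max 0 (min 1 (Y k \<omega> / t)))"
      by (auto simp: indicator_def simp flip: ennreal_1 intro!: ennreal_leI)
    then show "indicator {\<omega> \<in> space M. t < (\<Sum>k\<in>I. Y k \<omega>)} \<omega>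
        \<le> (\<Sum>k\<in>I. ennreal (max 0 (min 1 (Y k \<omega> / t))))"
      by (subst sum_ennreal) auto
  qed
  also have "\<dots> = (\<Sum>k\<in>I. \<integral>\<^sup>+\<omega>. ennreal (max 0 (min 1 (Y k \<omega> / t))) \<partial>M)"
    by (intro nn_integral_sum) measurable
  also have "\<dots> \<le> (\<Sum>k\<in>I. ennreal b)"
    by (intro sum_mono mean)
  also have "\<dots> = ennreal (real (card I) * b)"
    using \<open>0 \<le> b\<close> by (simp add: ennreal_mult'' ennreal_of_nat_eq_real_of_nat)
  finally show ?thesis
    using \<open>0 \<le> b\<close> by (simp add: emeasure_eq_measure)
qed

section \<open>Finitely many arrivals in bounded time\<close>

text \<open>If infinitely many arrivals occur by time \<open>t\<close>, then \<open>S\<^sub>n \<le> t\<close> for all \<open>n\<close>, since the waiting times are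
  positive. Exponential moments exclude this: \<open>\<P>(S\<^sub>n \<le> t) \<le> e\<^sup>t (\<E> e\<^sup>-\<^sup>T)\<^sup>n\<close>, and \<open>\<E> e\<^sup>-\<^sup>T < 1\<close> because \<open>T > 0\<close> almost
  surely.\<close>

lemma (in prob_space) AE_finite_arrivals:
  fixes T :: "nat \<Rightarrow> 'a \<Rightarrow> real"
  assumes indep: "indep_vars (\<lambda>_. borel) T {1..}"
    and law: "\<And>k. 1 \<le> k \<Longrightarrow> distr M borel (T k) = \<nu>"
    and \<nu>: "prob_space \<nu>" "sets \<nu> = sets borel" "measure \<nu> {0<..} = 1"
  shows "AE \<omega> in M. finite {n. arrival_time T n \<omega> \<le> t}"
proof -
  interpret \<nu>: prob_space \<nu> by fact
  have [measurable_cong]: "sets \<nu> = sets borel" by fact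
  have T[measurable]: "T k \<in> borel_measurable M" if "1 \<le> k" for k
    using indep that by (auto simp: indep_vars_def)
  have T_pos: "AE \<omega> in M. 0 < T k \<omega>" if "1 \<le> k" for k
  proof -
    have "AE x in \<nu>. x \<in> {0<..}"
      using \<nu> by (intro \<nu>.AE_prob_1) auto
    then have "AE x in distr M borel (T k). 0 < x"
      by (simp only: law[OF that] greaterThan_iff)
    then show ?thesis
      using T[OF that] by (subst (asm) AE_distr_iff) auto
  qed
  \<comment> \<open>The positive part makes \<open>e \<le> 1\<close> everywhere and agrees with \<open>x\<close> outside a null set.\<close>
  define e where "e x = exp (- max 0 x)" for x :: real
  have e: "0 \<le> e x" "e x \<le> 1" for x by (auto simp: e_def)
  have [measurable]: "e \<in> borel_measurable borel" unfolding e_def by measurable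
  have e_int: "integrable \<nu> e"
    by (rule \<nu>.integrable_const_bound[of _ 1]) (use e in \<open>auto simp: e_def\<close>)
  define r where "r = (\<integral>x. e x \<partial>\<nu>)"
  have "AE x in \<nu>. x \<in> {0<..}"
    using \<nu> by (intro \<nu>.AE_prob_1) auto
  then have "r < 1"
    unfolding r_def by (intro \<nu>.expectation_less e_int) (auto simp: e_def)
  have "0 \<le> r" unfolding r_def using e by (intro integral_nonneg_AE) auto
  have e_T: "(\<integral>\<^sup>+\<omega>. ennreal (e (T k \<omega>)) \<partial>M) = ennreal r" if k: "1 \<le> k" for k
  proof -
    have "(\<integral>\<^sup>+\<omega>. ennreal (e (T k \<omega>)) \<partial>M) = (\<integral>\<^sup>+x. ennreal (e x) \<partial>\<nu>)"
      unfolding law[OF k, symmetric] using T[OF k] by (subst nn_integral_distr) auto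
    also have "\<dots> = ennreal r"
      unfolding r_def using e e_int by (intro nn_integral_eq_integral) auto
    finally show ?thesis .
  qed
  define B where "B = {\<omega> \<in> space M. (\<forall>n. arrival_time T n \<omega> \<le> t) \<and> (\<forall>k\<in>{1..}. 0 < T k \<omega>)}"
  have S[measurable]: "arrival_time T n \<in> borel_measurable M" for n
    unfolding arrival_time_def[abs_def] by (intro borel_measurable_sum T) auto
  have [measurable]: "B \<in> sets M"
    unfolding B_def by measurable
  have B_le: "prob B \<le> exp t * r ^ n" for n
  proof -
    have "emeasure M B = (\<integral>\<^sup>+\<omega>. indicator B \<omega> \<partial>M)"
      by simp
    also have "\<dots> \<le> (\<integral>\<^sup>+\<omega>. ennreal (exp t) * (\<Prod>k=1..n. ennreal (e (T k \<omega>))) \<partial>M)"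
    proof (rule nn_integral_mono)
      fix \<omega>
      have "1 \<le> exp t * (\<Prod>k=1..n. e (T k \<omega>))" if "\<omega> \<in> B"
      proof -
        have "(\<Prod>k=1..n. e (T k \<omega>)) = (\<Prod>k=1..n. exp (- T k \<omega>))"
          using that by (intro prod.cong) (auto simp: B_def e_def max_def not_less less_imp_le)
        also have "\<dots> = exp (- arrival_time T n \<omega>)"
          by (simp add: exp_sum arrival_time_def sum_negf flip: exp_sum)
        finally have "exp t * (\<Prod>k=1..n. e (T k \<omega>)) = exp (t - arrival_time T n \<omega>)"
          by (simp add: exp_diff exp_minus divide_inverse)
        then show ?thesis
          using that by (simp add: B_def)
      qed
      then have "indicator B \<omega> \<le> ennreal (exp t * (\<Prod>k=1..n. e (T k \<omega>)))"
        by (auto simp: indicator_def simp flip: ennreal_1 intro!: ennreal_leI)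
      then show "indicator B \<omega> \<le> ennreal (exp t) * (\<Prod>k=1..n. ennreal (e (T k \<omega>)))"
        using e by (simp add: prod_ennreal ennreal_mult prod_nonneg)
    qed
    also have "\<dots> = ennreal (exp t) * (\<integral>\<^sup>+\<omega>. (\<Prod>k=1..n. ennreal (e (T k \<omega>))) \<partial>M)"
      by (intro nn_integral_cmult borel_measurable_prod_ennreal) auto
    also have "(\<integral>\<^sup>+\<omega>. (\<Prod>k=1..n. ennreal (e (T k \<omega>))) \<partial>M) =
        (\<Prod>k=1..n. \<integral>\<^sup>+\<omega>. ennreal (e (T k \<omega>)) \<partial>M)"
      by (intro indep_vars_nn_integral indep_vars_compose2[OF indep_vars_subset[OF indep]]) auto
    also have "\<dots> = ennreal (r ^ n)"
      using \<open>0 \<le> r\<close> e_T by (simp add: ennreal_power)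
    finally show ?thesis
      using \<open>0 \<le> r\<close> by (simp add: emeasure_eq_measure flip: ennreal_mult)
  qed
  have "(\<lambda>n. exp t * r ^ n) \<longlonglongrightarrow> exp t * 0"
    using \<open>0 \<le> r\<close> \<open>r < 1\<close> by (intro tendsto_intros LIMSEQ_power_zero) auto
  then have "prob B \<le> exp t * 0"
    by (rule LIMSEQ_le_const) (use B_le in auto)
  then have "prob B = 0"
    using measure_nonneg[of M B] by simp
  then have "B \<in> null_sets M"
    by (auto simp: null_sets_def emeasure_eq_measure)
  then have "AE \<omega> in M. \<omega> \<notin> B"
    by (rule AE_not_in)
  moreover have "AE \<omega> in M. \<forall>k\<in>{1..}. 0 < T k \<omega>"
    using T_pos by (subst AE_ball_countable) auto
  ultimately show ?thesis
    using AE_space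
  proof eventually_elim
    case (elim \<omega>)
    then have pos: "\<And>k. 1 \<le> k \<Longrightarrow> 0 < T k \<omega>"
      by simp
    obtain m where m: "t < arrival_time T m \<omega>"
      using elim by (auto simp: B_def not_le)
    have "n < m" if "arrival_time T n \<omega> \<le> t" for n
    proof (rule ccontr)
      assume "\<not> n < m"
      then have "arrival_time T m \<omega> \<le> arrival_time T n \<omega>"
        unfolding arrival_time_def using pos by (intro sum_mono2) (auto simp: less_imp_le)
      then show False using m that by simp
    qed
    then have "{n. arrival_time T n \<omega> \<le> t} \<subseteq> {..<m}" by auto
    then show ?case by (rule finite_subset) simp
  qed
qed

section \<open>Convergence of the embedded chain\<close>

text \<open>The least positive difference \<open>d\<close> of two elements divides every element, since the remainder of
  an element modulo \<open>d\<close> is itself such a difference; hence \<open>d = 1\<close>. So two consecutive numbers \<open>b\<close>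
  and \<open>b + 1\<close> are available (adjoining \<open>0\<close>), and a large \<open>n\<close> is a combination of them: divide \<open>n\<close> by
  \<open>b\<close> and replace as many summands \<open>b\<close> by \<open>b + 1\<close> as the remainder requires.\<close>

lemma numerical_semigroup_cofinite:
  fixes A :: "nat set"
  assumes add: "\<And>a b. a \<in> A \<Longrightarrow> b \<in> A \<Longrightarrow> a + b \<in> A" and Gcd: "Gcd A = 1"
  shows "\<exists>N. \<forall>n\<ge>N. n \<in> A"
proof -
  define A0 where "A0 = insert 0 A"
  have add0: "a + b \<in> A0" if "a \<in> A0" "b \<in> A0" for a b
    using that add by (auto simp: A0_def)
  have mult0: "q * a \<in> A0" if "a \<in> A0" for q a
    by (induction q) (use that add0 in \<open>auto simp: A0_def\<close>)
  define D where "D d \<longleftrightarrow> 0 < d \<and> (\<exists>b\<in>A0. b + d \<in> A0)" for d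
  have "\<not> A \<subseteq> {0}"
    using Gcd by (metis Gcd_0_iff zero_neq_one)
  then obtain x where "x \<in> A" "0 < x" by auto
  then have "D x" by (auto simp: D_def A0_def)
  define d where "d = (LEAST d. D d)"
  have "D d" unfolding d_def by (rule LeastI[of D x]) fact
  then obtain b where d: "0 < d" and b: "b \<in> A0" "b + d \<in> A0" by (auto simp: D_def)
  have "d dvd x" if "x \<in> A" for x
  proof -
    have "x + x div d * b = x div d * (b + d) + x mod d"
      by (simp add: algebra_simps)
    moreover have "x + x div d * b \<in> A0"
      using that by (intro add0 mult0 b) (simp add: A0_def)
    moreover have "x div d * (b + d) \<in> A0"
      by (rule mult0[OF b(2)])
    ultimately have "D (x mod d)" if "x mod d \<noteq> 0"
      using that unfolding D_def by (metis neq0_conv)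
    moreover have "\<not> D (x mod d)"
      using d not_less_Least[of "x mod d" D] by (simp add: d_def[symmetric])
    ultimately show ?thesis by (auto simp: dvd_eq_mod_eq_0)
  qed
  then have "d dvd Gcd A" by (rule Gcd_greatest)
  then have "d = 1" using Gcd by simp
  with b have b1: "b + 1 \<in> A0" by simp
  have "n \<in> A" if n: "b * b + 1 \<le> n" for n
  proof -
    have "n \<in> A0"
    proof (cases "b = 0")
      case True
      then show ?thesis using mult0[OF b1, of n] by simp
    next
      case False
      then have "n mod b < b" by simp
      moreover have "b \<le> n div b"
        using n False by (simp add: less_eq_div_iff_mult_less_eq)
      ultimately have "n mod b \<le> n div b" by simp
      then have "n = (n div b - n mod b) * b + n mod b * (b + 1)"
        by (simp add: algebra_simps diff_mult_distrib)
      then show ?thesis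
        using add0[OF mult0[OF b(1)] mult0[OF b1]] by metis
    qed
    then show "n \<in> A" using n by (auto simp: A0_def)
  qed
  then show ?thesis by blast
qed

lemma nstep_0: "nstep Q 0 i j = (if i = j then 1 else 0)"
  by (simp add: nstep_def mat_def)

lemma nstep_1: "nstep Q (Suc 0) i j = Q $ i $ j"
  by (simp add: nstep_def)

lemma nstep_add: "nstep Q (m + n) i j = (\<Sum>k\<in>UNIV. nstep Q m i k * nstep Q n k j)"
proof -
  have "((**) Q ^^ (m + n)) (mat 1) = ((**) Q ^^ m) (mat 1) ** ((**) Q ^^ n) (mat 1)"
    by (induction m) (simp_all add: matrix_mul_assoc)
  then show ?thesis
    by (simp add: nstep_def matrix_matrix_mult_def)
qed

lemma nstep_Suc: "nstep Q (Suc n) i j = (\<Sum>k\<in>UNIV. nstep Q n i k * Q $ k $ j)"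
  using nstep_add[of Q n 1] by (simp add: nstep_1)

lemma nstep_nonneg: "transition_matrix Q \<Longrightarrow> 0 \<le> nstep Q n i j"
  by (induction n arbitrary: j) (auto simp: nstep_0 nstep_Suc transition_matrix_def intro!: sum_nonneg)

lemma sum_nstep: "transition_matrix Q \<Longrightarrow> (\<Sum>j\<in>UNIV. nstep Q n i j) = 1"
proof (induction n)
  case (Suc n)
  have "(\<Sum>j\<in>UNIV. nstep Q (Suc n) i j) = (\<Sum>k\<in>UNIV. nstep Q n i k * (\<Sum>j\<in>UNIV. Q $ k $ j))"
    unfolding nstep_Suc sum_distrib_left by (rule sum.swap)
  then show ?case
    using Suc by (simp add: transition_matrix_def)
qed (simp add: nstep_0)

lemma invariant_nstep:
  assumes "invariant_distribution Q \<pi>"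
  shows "(\<Sum>i\<in>UNIV. \<pi> $ i * nstep Q n i j) = \<pi> $ j"
proof (induction n arbitrary: j)
  case 0
  then show ?case by (simp add: nstep_0 if_distrib[of "(*) _"] cong: if_cong)
next
  case (Suc n)
  have "(\<Sum>i\<in>UNIV. \<pi> $ i * nstep Q (Suc n) i j) =
      (\<Sum>i\<in>UNIV. \<Sum>k\<in>UNIV. \<pi> $ i * nstep Q n i k * Q $ k $ j)"
    by (simp add: nstep_Suc sum_distrib_left mult.assoc)
  also have "\<dots> = (\<Sum>k\<in>UNIV. (\<Sum>i\<in>UNIV. \<pi> $ i * nstep Q n i k) * Q $ k $ j)"
    unfolding sum_distrib_right by (rule sum.swap)
  also have "\<dots> = (\<pi> v* Q) $ j"
    by (simp add: Suc vector_matrix_mult_def mult.commute)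
  also have "\<dots> = \<pi> $ j"
    using assms by (simp add: invariant_distribution_def)
  finally show ?case .
qed

text \<open>The positive return times of a state form an additive semigroup with greatest common divisor \<open>1\<close>, so all
  large times are return times; prepending a loop of suitable length to a path from \<open>i\<close> to \<open>j\<close> gives
  paths of one length common to all pairs.\<close>

lemma irreducible_aperiodic_imp_primitive:
  fixes Q :: "real^'s^'s::finite"
  assumes Q: "transition_matrix Q" and irr: "irreducible_chain Q" and aper: "aperiodic_chain Q"
  shows "\<exists>m\<ge>1. \<forall>i j. 0 < nstep Q m i j"
proof -
  have pos_add: "0 < nstep Q (m + n) i j" if "0 < nstep Q m i k" "0 < nstep Q n k j" for m n i j k
  proof -
    have "0 < nstep Q m i k * nstep Q n k j" using that by simp
    also have "\<dots> \<le> nstep Q (m + n) i j"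
      unfolding nstep_add using nstep_nonneg[OF Q] by (intro member_le_sum) auto
    finally show ?thesis .
  qed
  have "\<exists>N. \<forall>n\<ge>N. 0 < nstep Q n i i" for i
  proof -
    have "\<exists>N. \<forall>n\<ge>N. n \<in> {n. 1 \<le> n \<and> 0 < nstep Q n i i}"
      using aper by (intro numerical_semigroup_cofinite) (auto simp: aperiodic_chain_def intro: pos_add)
    then show ?thesis by blast
  qed
  then obtain N where N: "\<And>i n. N i \<le> n \<Longrightarrow> 0 < nstep Q n i i" by metis
  obtain h where h: "\<And>i j. 0 < nstep Q (h i j) i j"
    using irr unfolding irreducible_chain_def by metis
  define m where "m = 1 + (\<Sum>i\<in>UNIV. N i) + (\<Sum>i\<in>UNIV. \<Sum>j\<in>UNIV. h i j)"
  have "0 < nstep Q m i j" for i j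
  proof -
    have "N i \<le> (\<Sum>i\<in>UNIV. N i)"
      by (rule member_le_sum) auto
    moreover have "h i j \<le> (\<Sum>j\<in>UNIV. h i j)"
      by (rule member_le_sum) auto
    moreover have "(\<Sum>j\<in>UNIV. h i j) \<le> (\<Sum>i\<in>UNIV. \<Sum>j\<in>UNIV. h i j)"
      by (rule member_le_sum[of i UNIV "\<lambda>i. \<Sum>j\<in>UNIV. h i j"]) auto
    ultimately have "N i \<le> m - h i j" "m = (m - h i j) + h i j"
      by (auto simp: m_def)
    then show ?thesis
      using pos_add[OF N h] by metis
  qed
  moreover have "1 \<le> m" by (simp add: m_def)
  ultimately show ?thesis by blast
qed

lemma sum_abs_kernel_le:
  fixes v :: "'a \<Rightarrow> real" and R :: "'a \<Rightarrow> 'b \<Rightarrow> real"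
  assumes "\<And>s j. 0 \<le> R s j" and "\<And>s. (\<Sum>j\<in>B. R s j) = c"
  shows "(\<Sum>j\<in>B. \<bar>\<Sum>s\<in>A. v s * R s j\<bar>) \<le> c * (\<Sum>s\<in>A. \<bar>v s\<bar>)"
proof -
  have "(\<Sum>j\<in>B. \<bar>\<Sum>s\<in>A. v s * R s j\<bar>) \<le> (\<Sum>j\<in>B. \<Sum>s\<in>A. \<bar>v s\<bar> * R s j)"
    using assms(1) by (intro sum_mono order.trans[OF sum_abs]) (simp add: abs_mult)
  also have "\<dots> = (\<Sum>s\<in>A. \<bar>v s\<bar> * (\<Sum>j\<in>B. R s j))"
    unfolding sum_distrib_left by (rule sum.swap)
  finally show ?thesis
    by (simp add: assms(2) sum_distrib_left mult.commute)
qed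

text \<open>Doeblin's argument. Passing from time \<open>n\<close> to \<open>n + m\<close> applies the kernel \<open>q\<^sup>(\<^sup>m\<^sup>)\<close> to the signed measure
  \<open>v = q\<^sup>(\<^sup>n\<^sup>)(i, -) - \<pi>\<close>. As \<open>v\<close> has total mass \<open>0\<close>, subtracting \<open>\<delta> \<pi>\<close> from every row of the kernel changes
  nothing, and what is left is nonnegative with row sums \<open>1 - \<delta>\<close>. The case \<open>\<delta> = 0\<close> is monotonicity.\<close>

lemma tv_dist_nstep_contract:
  assumes Q: "transition_matrix Q" and inv: "invariant_distribution Q \<pi>"
    and minor: "\<And>s j. \<delta> * \<pi> $ j \<le> nstep Q m s j"
  shows "tv_dist (nstep Q (n + m) i) (($) \<pi>) \<le> (1 - \<delta>) * tv_dist (nstep Q n i) (($) \<pi>)"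
proof -
  define v where "v s = nstep Q n i s - \<pi> $ s" for s
  have v0: "(\<Sum>s\<in>UNIV. v s) = 0"
    using inv sum_nstep[OF Q] by (simp add: v_def sum_subtractf invariant_distribution_def)
  have "nstep Q (n + m) i j - \<pi> $ j = (\<Sum>s\<in>UNIV. v s * (nstep Q m s j - \<delta> * \<pi> $ j))" for j
  proof -
    have "(\<Sum>s\<in>UNIV. v s * (nstep Q m s j - \<delta> * \<pi> $ j)) =
        (\<Sum>s\<in>UNIV. v s * nstep Q m s j) - (\<Sum>s\<in>UNIV. v s) * (\<delta> * \<pi> $ j)"
      by (simp add: right_diff_distrib sum_subtractf sum_distrib_right)
    also have "\<dots> = nstep Q (n + m) i j - \<pi> $ j"
      unfolding v0 using invariant_nstep[OF inv, of m j]
      by (simp add: v_def left_diff_distrib sum_subtractf nstep_add)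
    finally show ?thesis by simp
  qed
  moreover have "(\<Sum>j\<in>UNIV. \<bar>\<Sum>s\<in>UNIV. v s * (nstep Q m s j - \<delta> * \<pi> $ j)\<bar>) \<le>
      (1 - \<delta>) * (\<Sum>s\<in>UNIV. \<bar>v s\<bar>)"
    using minor inv sum_nstep[OF Q]
    by (intro sum_abs_kernel_le)
       (auto simp: sum_subtractf invariant_distribution_def simp flip: sum_distrib_left)
  ultimately show ?thesis
    by (simp add: tv_dist_def v_def)
qed

lemma tv_dist_nstep_antimono:
  assumes Q: "transition_matrix Q" and inv: "invariant_distribution Q \<pi>" and "m \<le> n"
  shows "tv_dist (nstep Q n i) (($) \<pi>) \<le> tv_dist (nstep Q m i) (($) \<pi>)"
  using tv_dist_nstep_contract[OF Q inv, of 0 "n - m" m i] nstep_nonneg[OF Q] \<open>m \<le> n\<close> by simp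

lemma tv_dist_le_1:
  assumes "\<And>x. 0 \<le> \<mu> x" "\<And>x. 0 \<le> \<rho> x" "(\<Sum>x\<in>UNIV. \<mu> x) = 1" "(\<Sum>x\<in>UNIV. \<rho> x) = 1"
  shows "tv_dist \<mu> \<rho> \<le> 1"
proof -
  have "(\<Sum>x\<in>UNIV. \<bar>\<mu> x - \<rho> x\<bar>) \<le> (\<Sum>x\<in>UNIV. \<mu> x + \<rho> x)"
    using assms(1,2) by (intro sum_mono) (simp add: abs_le_iff add_increasing add_increasing2)
  then show ?thesis
    using assms(3,4) by (simp add: tv_dist_def sum.distrib)
qed

text \<open>If all entries of \<open>q\<^sup>(\<^sup>m\<^sup>)\<close> are at least \<open>\<delta> > 0\<close>, then they dominate \<open>\<delta> \<pi>\<close>, so every \<open>m\<close> steps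
  shrink the distance by the factor \<open>1 - \<delta>\<close>; monotonicity takes care of the times in between.\<close>

lemma tv_dist_nstep_tendsto_0:
  fixes Q :: "real^'s^'s::finite"
  assumes Q: "transition_matrix Q" and irr: "irreducible_chain Q" and aper: "aperiodic_chain Q"
    and inv: "invariant_distribution Q \<pi>"
  shows "(\<lambda>n. tv_dist (nstep Q n i) (($) \<pi>)) \<longlonglongrightarrow> 0"
proof -
  obtain m where m: "1 \<le> m" and pos: "\<And>i j. 0 < nstep Q m i j"
    using irreducible_aperiodic_imp_primitive[OF Q irr aper] by blast
  define \<delta> where "\<delta> = Min (range (\<lambda>(s, j). nstep Q m s j))"
  have \<delta>_pos: "0 < \<delta>"
  proof -
    have "\<delta> \<in> range (\<lambda>(s, j). nstep Q m s j)"
      unfolding \<delta>_def by (intro Min_in finite_imageI finite) simp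
    then show ?thesis using pos by auto
  qed
  have \<delta>_le: "\<delta> \<le> nstep Q m s j" for s j
  proof -
    have "\<delta> \<le> (\<lambda>(s, j). nstep Q m s j) (s, j)"
      unfolding \<delta>_def by (intro Min_le rangeI finite_imageI finite)
    then show ?thesis by simp
  qed
  have \<pi>_nonneg: "0 \<le> \<pi> $ j" and \<pi>_sum: "(\<Sum>j\<in>UNIV. \<pi> $ j) = 1" for j
    using inv unfolding invariant_distribution_def by blast+
  have \<pi>_le_1: "\<pi> $ j \<le> 1" for j
    unfolding \<pi>_sum[symmetric] using \<pi>_nonneg by (intro member_le_sum) auto
  have minor: "\<delta> * \<pi> $ j \<le> nstep Q m s j" for s j
    using mult_left_le[OF \<pi>_le_1[of j] less_imp_le[OF \<delta>_pos]] \<delta>_le[of s j] by (rule order.trans)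
  have "\<delta> \<le> 1"
  proof -
    have "(\<Sum>j\<in>UNIV. \<delta> * \<pi> $ j) \<le> (\<Sum>j\<in>UNIV. nstep Q m i j)"
      by (intro sum_mono minor)
    then show ?thesis
      by (simp add: sum_nstep[OF Q] \<pi>_sum flip: sum_distrib_left)
  qed
  have tv_nonneg: "0 \<le> tv_dist \<mu> \<rho>" for \<mu> \<rho> :: "'s \<Rightarrow> real"
    by (simp add: tv_dist_def sum_nonneg)
  have bound: "tv_dist (nstep Q (k * m) i) (($) \<pi>) \<le> (1 - \<delta>) ^ k * tv_dist (nstep Q 0 i) (($) \<pi>)" for k
  proof (induction k)
    case (Suc k)
    have "tv_dist (nstep Q (Suc k * m) i) (($) \<pi>) \<le> (1 - \<delta>) * tv_dist (nstep Q (k * m) i) (($) \<pi>)"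
      using tv_dist_nstep_contract[OF Q inv minor, of "k * m" i] by (simp only: mult_Suc add.commute[of m])
    also have "\<dots> \<le> (1 - \<delta>) * ((1 - \<delta>) ^ k * tv_dist (nstep Q 0 i) (($) \<pi>))"
      using Suc \<open>\<delta> \<le> 1\<close> by (intro mult_left_mono) simp_all
    finally show ?case by (simp add: mult.assoc)
  qed simp
  have "(\<lambda>k. (1 - \<delta>) ^ k * tv_dist (nstep Q 0 i) (($) \<pi>)) \<longlonglongrightarrow> 0 * tv_dist (nstep Q 0 i) (($) \<pi>)"
    using \<delta>_pos \<open>\<delta> \<le> 1\<close> by (intro tendsto_mult LIMSEQ_power_zero tendsto_const) simp
  then have lim: "(\<lambda>k. (1 - \<delta>) ^ k * tv_dist (nstep Q 0 i) (($) \<pi>)) \<longlonglongrightarrow> 0"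
    by simp
  have "filterlim (\<lambda>n. n div m) sequentially sequentially"
    using m by (intro filterlim_at_top_div_const_nat) simp
  from filterlim_compose[OF lim this]
  have lim': "(\<lambda>n. (1 - \<delta>) ^ (n div m) * tv_dist (nstep Q 0 i) (($) \<pi>)) \<longlonglongrightarrow> 0" .
  have bound': "tv_dist (nstep Q n i) (($) \<pi>) \<le> (1 - \<delta>) ^ (n div m) * tv_dist (nstep Q 0 i) (($) \<pi>)" for n
    using tv_dist_nstep_antimono[OF Q inv, of "n div m * m" n i] bound[of "n div m"] by simp
  show ?thesis
    by (rule tendsto_sandwich[OF _ _ tendsto_const lim']) (use bound' tv_nonneg in simp_all)
qed

text \<open>The infimum over a nonempty set of natural numbers is a minimum, and convergence to \<open>\<pi>\<close> makes
  the set nonempty.\<close>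

lemma mixing_time_emb_attained:
  fixes Q :: "real^'s^'s::finite"
  assumes Q: "transition_matrix Q" and irr: "irreducible_chain Q" and aper: "aperiodic_chain Q"
    and inv: "invariant_distribution Q \<pi>" and "0 < \<epsilon>"
  shows "1 \<le> mixing_time_emb Q \<pi> \<epsilon>"
    and "(\<Sum>i\<in>UNIV. tv_dist (nstep Q (mixing_time_emb Q \<pi> \<epsilon>) i) (($) \<pi>)) \<le> \<epsilon>"
proof -
  let ?d = "\<lambda>n i. tv_dist (nstep Q n i) (($) \<pi>)"
  let ?S = "{n. 1 \<le> n \<and> (\<Sum>i\<in>UNIV. ?d n i) \<le> \<epsilon>}"
  have "(\<lambda>n. \<Sum>i\<in>UNIV. ?d n i) \<longlonglongrightarrow> (\<Sum>i\<in>(UNIV :: 's set). 0)"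
    by (intro tendsto_sum tv_dist_nstep_tendsto_0[OF Q irr aper inv])
  then have "\<forall>\<^sub>F n in sequentially. (\<Sum>i\<in>UNIV. ?d n i) < \<epsilon>"
    using \<open>0 < \<epsilon>\<close> by (intro order_tendstoD(2)) simp_all
  then have "\<forall>\<^sub>F n in sequentially. n \<in> ?S"
    using eventually_ge_at_top[of 1] by eventually_elim simp
  then obtain n where "n \<in> ?S"
    using eventually_happens'[OF sequentially_bot] by blast
  then have "mixing_time_emb Q \<pi> \<epsilon> \<in> ?S"
    unfolding mixing_time_emb_def by (intro Inf_nat_def1) auto
  then show "1 \<le> mixing_time_emb Q \<pi> \<epsilon>" "(\<Sum>i\<in>UNIV. ?d (mixing_time_emb Q \<pi> \<epsilon>) i) \<le> \<epsilon>"
    by auto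
qed

section \<open>The process as a mixture of the embedded chain\<close>

text \<open>The Markov property is given for complete histories. Summing over the finitely many histories that
  end in a state \<open>s\<close>, all of which have the same transition probability from \<open>s\<close>, yields the
  one-step relation for the marginals.\<close>

lemma (in prob_space) markov_chain_prob_Suc:
  fixes X :: "nat \<Rightarrow> 'a \<Rightarrow> 's::finite"
  assumes X: "markov_chain M Q X"
  shows "\<P>(\<omega> in M. X (Suc n) \<omega> = j) = (\<Sum>s\<in>UNIV. \<P>(\<omega> in M. X n \<omega> = s) * Q $ s $ j)"
proof -
  have [measurable]: "X n \<in> measurable M (count_space UNIV)" for n
    using X by (simp add: markov_chain_def)
  define H where "H x \<omega> \<longleftrightarrow> (\<forall>k\<in>{..n}. X k \<omega> = x k)" for x \<omega>
  have [measurable]: "Measurable.pred M (H x)" for x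
    unfolding H_def by measurable
  have hist: "\<P>(\<omega> in M. X (Suc n) \<omega> = j \<and> H x \<omega>) = \<P>(\<omega> in M. H x \<omega>) * Q $ x n $ j" for x
  proof (cases "\<P>(\<omega> in M. H x \<omega>) = 0")
    case True
    have "\<P>(\<omega> in M. X (Suc n) \<omega> = j \<and> H x \<omega>) \<le> \<P>(\<omega> in M. H x \<omega>)"
      by (intro finite_measure_mono) auto
    with True show ?thesis
      using measure_nonneg[of M "{\<omega> \<in> space M. X (Suc n) \<omega> = j \<and> H x \<omega>}"] by simp
  next
    case False
    then have "0 < \<P>(\<omega> in M. H x \<omega>)"
      by (simp add: zero_less_measure_iff)
    then have "\<P>(\<omega> in M. X (Suc n) \<omega> = j \<bar> H x \<omega>) = Q $ x n $ j"
      using X unfolding markov_chain_def H_def Ball_def atMost_iff by blast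
    with False show ?thesis
      by (simp add: cond_prob_def field_simps)
  qed
  define I where "I s = {x \<in> PiE {..n} (\<lambda>_. UNIV :: 's set). x n = s}" for s
  have fin: "finite (I s)" for s
    unfolding I_def by (intro finite_subset[OF _ finite_PiE[of "{..n}" "\<lambda>_. UNIV"]]) auto
  have ex1: "\<exists>!x\<in>I s. H x \<omega>" if "X n \<omega> = s" for s \<omega>
  proof (rule ex1I[of _ "restrict (\<lambda>k. X k \<omega>) {..n}"])
    show "restrict (\<lambda>k. X k \<omega>) {..n} \<in> I s \<and> H (restrict (\<lambda>k. X k \<omega>) {..n}) \<omega>"
      using that by (auto simp: I_def H_def)
    fix x assume "x \<in> I s \<and> H x \<omega>"
    then show "x = restrict (\<lambda>k. X k \<omega>) {..n}"
      by (intro extensionalityI[of _ "{..n}"]) (auto simp: I_def H_def PiE_def)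
  qed
  have I_H: "X n \<omega> = s" if "x \<in> I s" "H x \<omega>" for x s \<omega>
    using that by (auto simp: I_def H_def)
  have now: "\<P>(\<omega> in M. X n \<omega> = s) = (\<Sum>x\<in>I s. \<P>(\<omega> in M. H x \<omega>))" for s
    using ex1 I_H by (intro prob_sum fin AE_I2) (measurable, blast)
  have step: "\<P>(\<omega> in M. X n \<omega> = s \<and> X (Suc n) \<omega> = j) = \<P>(\<omega> in M. X n \<omega> = s) * Q $ s $ j" for s
  proof -
    have "\<P>(\<omega> in M. X n \<omega> = s \<and> X (Suc n) \<omega> = j) = (\<Sum>x\<in>I s. \<P>(\<omega> in M. X (Suc n) \<omega> = j \<and> H x \<omega>))"
      using ex1 I_H by (intro prob_sum fin AE_I2) (auto, blast)
    also have "\<dots> = (\<Sum>x\<in>I s. \<P>(\<omega> in M. H x \<omega>) * Q $ s $ j)"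
      unfolding hist by (rule sum.cong) (auto simp: I_def)
    finally show ?thesis
      by (simp add: now sum_distrib_right)
  qed
  have "\<P>(\<omega> in M. X (Suc n) \<omega> = j) = (\<Sum>s\<in>UNIV. \<P>(\<omega> in M. X n \<omega> = s \<and> X (Suc n) \<omega> = j))"
    by (intro prob_sum AE_I2) auto
  then show ?thesis
    by (simp add: step)
qed

lemma (in prob_space) markov_chain_prob:
  assumes X: "markov_chain M Q X" and X0: "AE \<omega> in M. X 0 \<omega> = i"
  shows "\<P>(\<omega> in M. X n \<omega> = j) = nstep Q n i j"
proof (induction n arbitrary: j)
  case 0
  have [measurable]: "X 0 \<in> measurable M (count_space UNIV)"
    using X by (simp add: markov_chain_def)
  have "\<P>(\<omega> in M. X 0 \<omega> = j) = \<P>(\<omega> in M. i = j)"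
    using X0 by (intro prob_eq_AE) auto
  then show ?case
    by (simp add: nstep_0 prob_space)
next
  case (Suc n)
  show ?case
    unfolding markov_chain_prob_Suc[OF X] Suc nstep_Suc ..
qed

lemma measurable_counting_process [measurable]:
  assumes [measurable]: "\<And>k. 1 \<le> k \<Longrightarrow> T k \<in> borel_measurable M"
  shows "counting_process T t \<in> measurable M (count_space UNIV)"
proof -
  have [measurable]: "arrival_time T n \<in> borel_measurable M" for n
    unfolding arrival_time_def[abs_def] by (intro borel_measurable_sum assms) auto
  show ?thesis
    unfolding counting_process_def[abs_def] by measurable
qed

text \<open>Independence is stated for the \<open>\<sigma>\<close>-algebras generated by the two processes, so both events have to
  be exhibited as preimages of measurable sets of trajectories. The counting process is the same
  functional of the trajectory of waiting times restricted to positive indices.\<close>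

lemma (in prob_space) chain_indep_counting_process:
  assumes "indep_chain_times M X T"
  shows "\<P>(\<omega> in M. counting_process T t \<omega> = k \<and> X k \<omega> = j) =
    \<P>(\<omega> in M. counting_process T t \<omega> = k) * \<P>(\<omega> in M. X k \<omega> = j)"
proof -
  let ?PX = "PiM UNIV (\<lambda>_::nat. count_space UNIV)" and ?PT = "PiM {1::nat..} (\<lambda>_. borel :: real measure)"
  let ?X = "\<lambda>\<omega> n. X n \<omega>" and ?T = "\<lambda>\<omega>. \<lambda>k\<in>{1..}. T k \<omega>"
  have "(\<lambda>x. x k) \<in> measurable ?PX (count_space UNIV)"
    by (rule measurable_component_singleton) simp
  then have "(\<lambda>x. x k) -` {j} \<inter> space ?PX \<in> sets ?PX"
    by (rule measurable_sets) simp
  then have "?X -` ((\<lambda>x. x k) -` {j} \<inter> space ?PX) \<inter> space M \<in> sets (vimage_algebra (space M) ?X ?PX)"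
    by (rule in_vimage_algebra)
  moreover have "?X -` ((\<lambda>x. x k) -` {j} \<inter> space ?PX) \<inter> space M = {\<omega> \<in> space M. X k \<omega> = j}"
    by (auto simp: space_PiM)
  ultimately have EX: "{\<omega> \<in> space M. X k \<omega> = j} \<in> sets (vimage_algebra (space M) ?X ?PX)"
    by simp
  let ?N = "counting_process (\<lambda>k x. x k) t :: (nat \<Rightarrow> real) \<Rightarrow> nat"
  have "?N \<in> measurable ?PT (count_space UNIV)"
    by (intro measurable_counting_process measurable_component_singleton) simp
  then have "?N -` {k} \<inter> space ?PT \<in> sets ?PT"
    by (rule measurable_sets) simp
  then have "?T -` (?N -` {k} \<inter> space ?PT) \<inter> space M \<in> sets (vimage_algebra (space M) ?T ?PT)"
    by (rule in_vimage_algebra)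
  moreover have "?N (?T \<omega>) = counting_process T t \<omega>" for \<omega>
    by (simp add: counting_process_def arrival_time_def)
  then have "?T -` (?N -` {k} \<inter> space ?PT) \<inter> space M = {\<omega> \<in> space M. counting_process T t \<omega> = k}"
    by (auto simp: space_PiM)
  ultimately have ET: "{\<omega> \<in> space M. counting_process T t \<omega> = k} \<in> sets (vimage_algebra (space M) ?T ?PT)"
    by simp
  have "{\<omega> \<in> space M. counting_process T t \<omega> = k \<and> X k \<omega> = j} =
      {\<omega> \<in> space M. X k \<omega> = j} \<inter> {\<omega> \<in> space M. counting_process T t \<omega> = k}"
    by auto
  then show ?thesis
    using indep_setD[OF assms[unfolded indep_chain_times_def] EX ET] by (simp add: mult.commute)
qed

lemma (in prob_space) semi_markov_prob_sums:
  assumes X: "markov_chain M Q X" and X0: "AE \<omega> in M. X 0 \<omega> = i"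
    and T: "\<And>k. 1 \<le> k \<Longrightarrow> T k \<in> borel_measurable M"
    and indep: "indep_chain_times M X T"
  shows "(\<lambda>k. \<P>(\<omega> in M. counting_process T t \<omega> = k) * nstep Q k i j) sums
    \<P>(\<omega> in M. semi_markov X T t \<omega> = j)"
proof -
  have [measurable]: "X n \<in> measurable M (count_space UNIV)" for n
    using X by (simp add: markov_chain_def)
  have [measurable]: "counting_process T t \<in> measurable M (count_space UNIV)"
    by (rule measurable_counting_process[OF T])
  have "(\<lambda>k. \<P>(\<omega> in M. counting_process T t \<omega> = k \<and> X k \<omega> = j)) sums
      \<P>(\<omega> in M. semi_markov X T t \<omega> = j)"
    unfolding semi_markov_def by (intro prob_sums AE_I2) auto
  then show ?thesis
    by (simp add: chain_indep_counting_process[OF indep] markov_chain_prob[OF X X0])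
qed

text \<open>Total variation is convex, so the distance of the mixture is at most the average of the distances
  of its components; the components of index below \<open>n\<close> are estimated by \<open>1\<close>, the others by \<open>b\<close>.\<close>

lemma tv_dist_mixture_le:
  fixes \<rho> :: "'s::finite \<Rightarrow> real"
  assumes a: "\<And>k. 0 \<le> a k" "a sums 1"
    and p: "\<And>j. (\<lambda>k. a k * q k j) sums p j"
    and le_1: "\<And>k. tv_dist (q k) \<rho> \<le> 1"
    and le_b: "\<And>k. n \<le> k \<Longrightarrow> tv_dist (q k) \<rho> \<le> b" and "0 \<le> b"
  shows "tv_dist p \<rho> \<le> (\<Sum>k<n. a k) + b"
proof -
  have diff: "(\<lambda>k. a k * (q k j - \<rho> j)) sums (p j - \<rho> j)" for j
    using sums_diff[OF p[of j] sums_mult2[OF a(2), of "\<rho> j"]] by (simp add: right_diff_distrib)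
  have term_le: "\<bar>a k * (q k j - \<rho> j)\<bar> \<le> a k * 2" for k j
  proof -
    have "\<bar>q k j - \<rho> j\<bar> \<le> (\<Sum>j\<in>UNIV. \<bar>q k j - \<rho> j\<bar>)"
      by (rule member_le_sum) auto
    also have "\<dots> \<le> 2"
      using le_1[of k] by (simp add: tv_dist_def)
    finally show ?thesis
      using a(1)[of k] by (simp add: abs_mult mult_left_mono)
  qed
  have summ: "summable (\<lambda>k. \<bar>a k * (q k j - \<rho> j)\<bar>)" for j
  proof (rule summable_comparison_test')
    show "summable (\<lambda>k. a k * 2)"
      using sums_summable[OF a(2)] by (rule summable_mult2)
    show "norm \<bar>a k * (q k j - \<rho> j)\<bar> \<le> a k * 2" for k
      using term_le by simp
  qed
  have "\<bar>p j - \<rho> j\<bar> \<le> (\<Sum>k. \<bar>a k * (q k j - \<rho> j)\<bar>)" for j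
    using summable_rabs[OF summ[of j]] unfolding sums_unique[OF diff[of j], symmetric] .
  then have "(\<Sum>j\<in>UNIV. \<bar>p j - \<rho> j\<bar>) \<le> (\<Sum>j\<in>UNIV. \<Sum>k. \<bar>a k * (q k j - \<rho> j)\<bar>)"
    by (intro sum_mono)
  also have "\<dots> = (\<Sum>k. \<Sum>j\<in>UNIV. \<bar>a k * (q k j - \<rho> j)\<bar>)"
    by (intro suminf_sum[symmetric] summ)
  also have "\<dots> = (\<Sum>k. 2 * (a k * tv_dist (q k) \<rho>))"
    using a(1) by (simp add: tv_dist_def abs_mult sum_distrib_left)
  finally have "tv_dist p \<rho> \<le> (1 / 2) * (\<Sum>k. 2 * (a k * tv_dist (q k) \<rho>))"
    by (simp add: tv_dist_def)
  also have "(\<Sum>k. 2 * (a k * tv_dist (q k) \<rho>)) \<le> (\<Sum>k. 2 * ((if k \<in> {..<n} then a k else 0) + a k * b))"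
  proof (rule suminf_le)
    show "summable (\<lambda>k. 2 * (a k * tv_dist (q k) \<rho>))"
      using summable_sum[of UNIV "\<lambda>j k. \<bar>a k * (q k j - \<rho> j)\<bar>"] summ a(1)
      by (simp add: tv_dist_def abs_mult sum_distrib_left)
    show "summable (\<lambda>k. 2 * ((if k \<in> {..<n} then a k else 0) + a k * b))"
      using sums_summable[OF a(2)]
      by (intro summable_mult summable_add summable_mult2 summable_If_finite_set) auto
    fix k
    show "2 * (a k * tv_dist (q k) \<rho>) \<le> 2 * ((if k \<in> {..<n} then a k else 0) + a k * b)"
    proof (cases "k < n")
      case True
      then show ?thesis
        using mult_left_mono[OF le_1 a(1), of k k] mult_nonneg_nonneg[OF a(1)[of k] \<open>0 \<le> b\<close>] by simp
    next
      case False
      then show ?thesis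
        using mult_left_mono[OF le_b a(1), of k k] by simp
    qed
  qed
  also have "(\<Sum>k. 2 * ((if k \<in> {..<n} then a k else 0) + a k * b)) = 2 * ((\<Sum>k<n. a k) + b)"
    using sums_mult[OF sums_add[OF sums_If_finite_set[of "{..<n}" a] sums_mult2[OF a(2), of b]], of 2]
    by (simp add: sums_iff)
  finally show ?thesis by simp
qed

section \<open>Comparison of the mixing times\<close>

text \<open>Almost surely the counting process is finite, and then \<open>N < n\<close> forces \<open>S\<^sub>n > t\<close>.\<close>

lemma (in prob_space) prob_counting_process_less_le:
  assumes indep: "indep_vars (\<lambda>_. borel) T {1..}"
    and distr: "\<And>k. 1 \<le> k \<Longrightarrow> distr M borel (T k) = \<nu>"
    and \<beta>: "0 < \<beta>" "\<beta> \<le> 1" and law: "mittag_leffler_law \<beta> \<nu>" and t: "0 < t"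
  shows "\<P>(\<omega> in M. counting_process T t \<omega> < n) \<le> real n * (Gamma \<beta> * t powr (- \<beta>))"
proof -
  have T[measurable]: "T k \<in> borel_measurable M" if "1 \<le> k" for k
    using indep that by (auto simp: indep_vars_def)
  have [measurable]: "counting_process T t \<in> measurable M (count_space UNIV)"
    by (rule measurable_counting_process[OF T])
  have [measurable]: "arrival_time T n \<in> borel_measurable M"
    unfolding arrival_time_def[abs_def] by (intro borel_measurable_sum T) auto
  have "AE \<omega> in M. finite {n. arrival_time T n \<omega> \<le> t}"
    using law by (intro AE_finite_arrivals[OF indep distr]) (auto simp: mittag_leffler_law_def)
  then have "AE \<omega> in M. counting_process T t \<omega> < n \<longrightarrow> t < arrival_time T n \<omega>"
  proof eventually_elim
    case (elim \<omega>)
    then show ?case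
      unfolding counting_process_def by (metis Max_ge mem_Collect_eq not_le)
  qed
  then have "\<P>(\<omega> in M. counting_process T t \<omega> < n) \<le> \<P>(\<omega> in M. t < arrival_time T n \<omega>)"
    by (intro finite_measure_mono_AE) auto
  also have "\<dots> \<le> real (card {1..n}) * (Gamma \<beta> * t powr (- \<beta>))"
    unfolding arrival_time_def
  proof (rule prob_sum_gt_le)
    fix k assume k: "k \<in> {1..n}"
    then have "1 \<le> k" by simp
    show "(\<integral>\<^sup>+\<omega>. ennreal (max 0 (min 1 (T k \<omega> / t))) \<partial>M) \<le> ennreal (Gamma \<beta> * t powr (- \<beta>))"
      using mittag_leffler_truncated_mean[OF \<beta> law t] T[OF \<open>1 \<le> k\<close>]
      unfolding distr[OF \<open>1 \<le> k\<close>, symmetric] by (subst (asm) nn_integral_distr) auto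
  qed (use T t \<beta> Gamma_real_pos[of \<beta>] in auto)
  finally show ?thesis by simp
qed

lemma (in prob_space) tv_dist_semi_markov_le:
  fixes X :: "nat \<Rightarrow> 'a \<Rightarrow> 's::finite"
  assumes Q: "transition_matrix Q" and inv: "invariant_distribution Q \<pi>"
    and X: "markov_chain M Q X" and X0: "AE \<omega> in M. X 0 \<omega> = i"
    and indep: "indep_vars (\<lambda>_. borel) T {1..}"
    and distr: "\<And>k. 1 \<le> k \<Longrightarrow> distr M borel (T k) = \<nu>"
    and indep_XT: "indep_chain_times M X T"
    and \<beta>: "0 < \<beta>" "\<beta> \<le> 1" and law: "mittag_leffler_law \<beta> \<nu>" and t: "0 < t"
  shows "tv_dist (\<lambda>j. \<P>(\<omega> in M. semi_markov X T t \<omega> = j)) (($) \<pi>)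
    \<le> real n * (Gamma \<beta> * t powr (- \<beta>)) + tv_dist (nstep Q n i) (($) \<pi>)"
proof -
  have T: "T k \<in> borel_measurable M" if "1 \<le> k" for k
    using indep that by (auto simp: indep_vars_def)
  have [measurable]: "counting_process T t \<in> measurable M (count_space UNIV)"
    by (rule measurable_counting_process[OF T])
  have "(\<lambda>k. \<P>(\<omega> in M. counting_process T t \<omega> = k)) sums \<P>(\<omega> in M. True)"
    by (rule prob_sums) auto
  then have total: "(\<lambda>k. \<P>(\<omega> in M. counting_process T t \<omega> = k)) sums 1"
    by (simp add: prob_space)
  have "tv_dist (\<lambda>j. \<P>(\<omega> in M. semi_markov X T t \<omega> = j)) (($) \<pi>)
      \<le> (\<Sum>k<n. \<P>(\<omega> in M. counting_process T t \<omega> = k)) + tv_dist (nstep Q n i) (($) \<pi>)"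
  proof (rule tv_dist_mixture_le[OF measure_nonneg total semi_markov_prob_sums[OF X X0 T indep_XT]])
    show "tv_dist (nstep Q k i) (($) \<pi>) \<le> 1" for k
      using inv by (intro tv_dist_le_1 nstep_nonneg sum_nstep Q) (auto simp: invariant_distribution_def)
    show "tv_dist (nstep Q k i) (($) \<pi>) \<le> tv_dist (nstep Q n i) (($) \<pi>)" if "n \<le> k" for k
      by (rule tv_dist_nstep_antimono[OF Q inv that])
    show "0 \<le> tv_dist (nstep Q n i) (($) \<pi>)"
      by (simp add: tv_dist_def sum_nonneg)
  qed
  also have "(\<Sum>k<n. \<P>(\<omega> in M. counting_process T t \<omega> = k)) = \<P>(\<omega> in M. counting_process T t \<omega> < n)"
    by (rule prob_sum[symmetric]) auto
  also have "\<dots> \<le> real n * (Gamma \<beta> * t powr (- \<beta>))"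
    by (rule prob_counting_process_less_le[OF indep distr \<beta> law t])
  finally show ?thesis by simp
qed

theorem theorem2p3:
  fixes Q :: "real^'s^'s::finite" and \<pi> :: "real^'s"
    and \<beta> :: real and \<nu> :: "real measure"
    and P :: "'s \<Rightarrow> 'w measure"
    and X :: "nat \<Rightarrow> 'w \<Rightarrow> 's" and T :: "nat \<Rightarrow> 'w \<Rightarrow> real"
  assumes "transition_matrix Q" and "irreducible_chain Q" and "aperiodic_chain Q"
    and "invariant_distribution Q \<pi>"
    and "0 < \<beta>" and "\<beta> \<le> 1"
    and "mittag_leffler_law \<beta> \<nu>"
    and "semi_markov_family Q \<nu> P X T"
  shows "\<exists>C>0. \<forall>\<epsilon>>0.
    mixing_time_cont P (semi_markov X T) \<pi> \<epsilon>
      < ereal (C * \<epsilon> powr (- 1 / \<beta>) * real (mixing_time_emb Q \<pi> (\<epsilon> / 2)) powr (1 / \<beta>))"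
proof -
  define c where "c = 2 * real CARD('s) * Gamma \<beta>"
  have c: "0 < c"
    using \<open>0 < \<beta>\<close> by (simp add: c_def Gamma_real_pos zero_less_card_finite)
  have main: "mixing_time_cont P (semi_markov X T) \<pi> \<epsilon>
      < ereal (2 * c powr (1 / \<beta>) * \<epsilon> powr (- 1 / \<beta>) * real (mixing_time_emb Q \<pi> (\<epsilon> / 2)) powr (1 / \<beta>))"
    if "0 < \<epsilon>" for \<epsilon>
  proof -
    define n where "n = mixing_time_emb Q \<pi> (\<epsilon> / 2)"
    have n: "1 \<le> n" "(\<Sum>i\<in>UNIV. tv_dist (nstep Q n i) (($) \<pi>)) \<le> \<epsilon> / 2"
      using mixing_time_emb_attained[OF assms(1-4), of "\<epsilon> / 2"] \<open>0 < \<epsilon>\<close> unfolding n_def by simp_all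
    define a where "a = 1 / \<beta>"
    define t where "t = (c * real n / \<epsilon>) powr a"
    have t: "0 < t"
      using c n \<open>0 < \<epsilon>\<close> by (simp add: t_def)
    have "t powr (- \<beta>) = (c * real n / \<epsilon>) powr (- 1)"
      using \<open>0 < \<beta>\<close> by (simp add: t_def a_def powr_powr)
    also have "\<dots> = \<epsilon> / (c * real n)"
      using c n \<open>0 < \<epsilon>\<close> by (simp add: powr_minus)
    finally have t_powr: "real n * (Gamma \<beta> * t powr (- \<beta>)) = \<epsilon> / (2 * real CARD('s))"
      using n Gamma_real_pos[OF \<open>0 < \<beta>\<close>] by (simp add: c_def)
    have tv: "tv_dist (transition_prob P (semi_markov X T) t i) (($) \<pi>)
        \<le> \<epsilon> / (2 * real CARD('s)) + tv_dist (nstep Q n i) (($) \<pi>)" for i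
    proof -
      have family: "prob_space (P i)" "markov_chain (P i) Q X" "AE \<omega> in P i. X 0 \<omega> = i"
          "prob_space.indep_vars (P i) (\<lambda>_. borel) T {1..}" "indep_chain_times (P i) X T"
        using \<open>semi_markov_family Q \<nu> P X T\<close> unfolding semi_markov_family_def by blast+
      have distr: "distr (P i) borel (T k) = \<nu>" if "1 \<le> k" for k
        using \<open>semi_markov_family Q \<nu> P X T\<close> that unfolding semi_markov_family_def by blast
      interpret prob_space "P i"
        by (rule family)
      have "tv_dist (\<lambda>j. \<P>(\<omega> in P i. semi_markov X T t \<omega> = j)) (($) \<pi>)
          \<le> real n * (Gamma \<beta> * t powr (- \<beta>)) + tv_dist (nstep Q n i) (($) \<pi>)"
        by (rule tv_dist_semi_markov_le[OF assms(1,4) family(2-4) distr family(5) assms(5-7) t])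
      then show ?thesis
        unfolding t_powr transition_prob_def[abs_def] .
    qed
    have "(\<Sum>i\<in>UNIV. tv_dist (transition_prob P (semi_markov X T) t i) (($) \<pi>))
        \<le> (\<Sum>i\<in>(UNIV :: 's set). \<epsilon> / (2 * real CARD('s))) + (\<Sum>i\<in>UNIV. tv_dist (nstep Q n i) (($) \<pi>))"
      unfolding sum.distrib[symmetric] by (intro sum_mono tv)
    also have "\<dots> \<le> \<epsilon> / 2 + \<epsilon> / 2"
      using n by (intro add_mono) auto
    finally have "mixing_time_cont P (semi_markov X T) \<pi> \<epsilon> \<le> ereal t"
      unfolding mixing_time_cont_def using t by (intro Inf_lower imageI) simp
    also have "ereal t < ereal (2 * t)"
      using t by simp
    also have "2 * t = 2 * c powr a * \<epsilon> powr (- a) * real n powr a"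
      using c n \<open>0 < \<epsilon>\<close> by (simp add: t_def powr_mult powr_divide powr_minus field_simps)
    finally show ?thesis
      by (simp add: a_def n_def)
  qed
  \<comment> \<open>The factor \<open>2\<close> makes the inequality strict.\<close>
  show ?thesis
    using c main by (intro exI[of _ "2 * c powr (1 / \<beta>)"]) simp
qed

end
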